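(* Let $a$ and $b$ be positive integers. All positive integer solutions of the equation $x^{2}-(a^{2}b^{2}-b)y^{2}=1$ are given by $$(x_{n},y_{n})=\begin{cases}\left(\tfrac{1}{2}V_{n}(2a,-1),\;U_{n}(2a,-1)\right) & \text{if } b=1,\\[4pt] \left(\tfrac{1}{2}V_{n}(4a^{2}b-2,-1),\;2a\,U_{n}(4a^{2}b-2,-1)\right) & \text{if } b>1,\end{cases}$$ with $n\ge 1$.
   Context: For non-zero integers $k,s$ with $k^2+4s>0$, the generalized Fibonacci sequence is defined by $U_0(k,s)=0$, $U_1(k,s)=1$, $U_{n+1}(k,s)=kU_n(k,s)+sU_{n-1}(k,s)$ for $n\ge 1$, and the generalized Lucas sequence by $V_0(k,s)=2$, $V_1(k,s)=k$, $V_{n+1}(k,s)=kV_n(k,s)+sV_{n-1}(k,s)$ for $n\ge 1$. *)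

theory Defs
  imports Complex_Main
begin

text \<open>
  The sequences are usually considered for non-zero \<open>k\<close>, \<open>s\<close> with \<open>k\<^sup>2 + 4 * s > 0\<close>.
  The recurrences make sense for all integer parameters and are stated without that restriction;
  in particular, the degenerate pair \<open>k = 2\<close>, \<open>s = -1\<close> (zero discriminant) is covered,
  where \<open>gen_fib k s n = n\<close> and \<open>gen_lucas k s n = 2\<close>.
\<close>

fun gen_fib :: "int \<Rightarrow> int \<Rightarrow> nat \<Rightarrow> int" where
  "gen_fib k s 0 = 0"
| "gen_fib k s (Suc 0) = 1"
| "gen_fib k s (Suc (Suc n)) = k * gen_fib k s (Suc n) + s * gen_fib k s n"

fun gen_lucas :: "int \<Rightarrow> int \<Rightarrow> nat \<Rightarrow> int" where
  "gen_lucas k s 0 = 2"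
| "gen_lucas k s (Suc 0) = k"
| "gen_lucas k s (Suc (Suc n)) = k * gen_lucas k s (Suc n) + s * gen_lucas k s n"

text \<open>
  The value is a pair of rationals because of the factor \<open>1 / 2\<close>: that the first component
  is an integer is part of the claim, so integer division is avoided.
\<close>

definition pell_sol :: "int \<Rightarrow> int \<Rightarrow> nat \<Rightarrow> rat \<times> rat" where
  "pell_sol a b n =
    (if b = 1
     then (1 / 2 * of_int (gen_lucas (2 * a) (- 1) n),
           of_int (gen_fib (2 * a) (- 1) n))
     else (1 / 2 * of_int (gen_lucas (4 * a\<^sup>2 * b - 2) (- 1) n),
           of_int (2 * a * gen_fib (4 * a\<^sup>2 * b - 2) (- 1) n)))"

end

theory Submission imports Defs begin

text \<open>
  Let \<open>(p, q)\<close> be a positive solution of \<open>x\<^sup>2 - d y\<^sup>2 = 1\<close>. Multiplying a positive solution \<open>(x, y)\<close>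
  by the inverse unit \<open>p - q \<surd>d\<close> gives the solution \<open>(p x - d q y, p y - q x)\<close>, whose second
  component is always smaller than \<open>y\<close>. If it is also never negative, then descent on \<open>y\<close> ends at
  \<open>(1, 0)\<close>, so every solution is a power of \<open>(p, q)\<close>, and those are \<open>(V\<^sub>n / 2, q U\<^sub>n)\<close> with parameters
  \<open>(2 p, -1)\<close>. For \<open>d = a\<^sup>2 b\<^sup>2 - b\<close> and \<open>b > 1\<close> take \<open>(p, q) = (2 a\<^sup>2 b - 1, 2 a)\<close>: with
  \<open>t = a b y - x\<close> one finds \<open>b y (p y - q x) = t\<^sup>2 - 1\<close>, and \<open>t \<ge> 1\<close>, so \<open>p y - q x \<ge> 0\<close>.
\<close>

text \<open>With \<open>D = p^2 - 1\<close>, these are the components of multiplying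
  \<open>V_n / 2 + U_n sqrt(D)\<close> by the unit \<open>p + sqrt(D)\<close>, with the halves
  cleared. They turn the second-order recurrences into a coupled one-step recurrence.\<close>

lemma gen_fib_lucas_Suc:
  "2 * gen_fib (2 * p) (- 1) (Suc n) = 2 * p * gen_fib (2 * p) (- 1) n + gen_lucas (2 * p) (- 1) n"
  "gen_lucas (2 * p) (- 1) (Suc n) =
    p * gen_lucas (2 * p) (- 1) n + 2 * (p\<^sup>2 - 1) * gen_fib (2 * p) (- 1) n"
proof (induction n)
  case (Suc n)
  {
    case 1
    show ?case using Suc.IH by (simp add: algebra_simps power2_eq_square)
  next
    case 2
    have "gen_lucas (2 * p) (- 1) (Suc (Suc n)) =
        2 * p * gen_lucas (2 * p) (- 1) (Suc n) - gen_lucas (2 * p) (- 1) n"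
      by simp
    then show ?case using Suc.IH by algebra
  }
qed simp_all

lemma even_gen_lucas: "even (gen_lucas (2 * p) s n)"
  by (induction "2 * p" s n rule: gen_lucas.induct) auto

text \<open>The unit \<open>p + sqrt(p^2 - 1)\<close> has norm 1, so all its powers do; the factor 4
  clears the halves.\<close>

lemma gen_lucas_fib_pell:
  "(gen_lucas (2 * p) (- 1) n)\<^sup>2 - 4 * (p\<^sup>2 - 1) * (gen_fib (2 * p) (- 1) n)\<^sup>2 = 4"
proof (induction n)
  case (Suc n)
  let ?U = "gen_fib (2 * p) (- 1)" and ?V = "gen_lucas (2 * p) (- 1)"
  have "(?V (Suc n))\<^sup>2 - 4 * (p\<^sup>2 - 1) * (?U (Suc n))\<^sup>2
      = (?V (Suc n))\<^sup>2 - (p\<^sup>2 - 1) * (2 * ?U (Suc n))\<^sup>2"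
    by (simp add: power_mult_distrib)
  also have "\<dots> = (?V n)\<^sup>2 - 4 * (p\<^sup>2 - 1) * (?U n)\<^sup>2"
    unfolding gen_fib_lucas_Suc by algebra
  finally show ?case using Suc by simp
qed simp

text \<open>The two signs go through one induction because each coupled recurrence involves both
  sequences; \<open>p \<ge> 1\<close> keeps all coefficients non-negative.\<close>

lemma gen_lucas_fib_pos:
  assumes "p \<ge> 1"
  shows "gen_lucas (2 * p) (- 1) n > 0 \<and> gen_fib (2 * p) (- 1) n \<ge> 0"
proof (induction n)
  case (Suc n)
  have "2 * (p\<^sup>2 - 1) * gen_fib (2 * p) (- 1) n \<ge> 0"
    using Suc assms by simp
  moreover have "p * gen_lucas (2 * p) (- 1) n > 0" "2 * p * gen_fib (2 * p) (- 1) n \<ge> 0"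
    using Suc assms by simp_all
  ultimately show ?case using Suc gen_fib_lucas_Suc[of p n] by linarith
qed simp

lemma gen_fib_Suc_pos:
  assumes "p \<ge> 1"
  shows "gen_fib (2 * p) (- 1) (Suc n) > 0"
proof -
  have "2 * p * gen_fib (2 * p) (- 1) n \<ge> 0"
    using gen_lucas_fib_pos[OF assms, of n] assms by simp
  then show ?thesis
    using gen_fib_lucas_Suc(1)[of p n] gen_lucas_fib_pos[OF assms, of n] by linarith
qed

lemma pell_descent:
  fixes p q d x y :: int
  assumes d: "d \<ge> 0" and p: "p \<ge> 1" and q: "q \<ge> 1" and pq: "p\<^sup>2 - d * q\<^sup>2 = 1"
    and desc: "\<And>x y. x > 0 \<Longrightarrow> y > 0 \<Longrightarrow> x\<^sup>2 - d * y\<^sup>2 = 1 \<Longrightarrow> q * x \<le> p * y"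
    and "x > 0" "y \<ge> 0" "x\<^sup>2 - d * y\<^sup>2 = 1"
  shows "\<exists>n. 2 * x = gen_lucas (2 * p) (- 1) n \<and> y = q * gen_fib (2 * p) (- 1) n"
  using \<open>x > 0\<close> \<open>y \<ge> 0\<close> \<open>x\<^sup>2 - d * y\<^sup>2 = 1\<close>
proof (induction "nat y" arbitrary: x y rule: less_induct)
  case less
  note x = \<open>x > 0\<close> and y = \<open>y \<ge> 0\<close> and xy = \<open>x\<^sup>2 - d * y\<^sup>2 = 1\<close>
  show ?case
  proof (cases "y = 0")
    case True
    then have "x\<^sup>2 = 1\<^sup>2" using xy by simp
    then have "x = 1" using x by (simp add: power2_eq_1_iff)
    then show ?thesis using True by (intro exI[of _ 0]) simp
  next
    case False
    define x' y' where "x' = p * x - d * q * y" and "y' = p * y - q * x"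
    have eq: "x'\<^sup>2 - d * y'\<^sup>2 = 1"
      using pq xy unfolding x'_def y'_def by algebra
    have y': "y' \<ge> 0"
      using desc[of x y] x y xy False by (simp add: y'_def)
    \<comment> \<open>Positivity of \<open>x'\<close> is read off from a comparison of
      squares.\<close>
    have "(p * x)\<^sup>2 - (d * q * y)\<^sup>2 = p\<^sup>2 + d * y\<^sup>2"
      using pq xy by algebra
    moreover have "p\<^sup>2 > 0" "d * y\<^sup>2 \<ge> 0" using p d by simp_all
    ultimately have "(d * q * y)\<^sup>2 < (p * x)\<^sup>2" by linarith
    then have "d * q * y < p * x" by (rule power2_less_imp_less) (use p x in simp)
    then have x': "x' > 0" by (simp add: x'_def)
    \<comment> \<open>The inequality \<open>y' < y\<close> is equivalent to
      \<open>(p - 1) * y < q * x\<close>, again shown by comparing squares.\<close>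
    have "(q * x)\<^sup>2 - ((p - 1) * y)\<^sup>2 = q\<^sup>2 + 2 * (p - 1) * y\<^sup>2"
      using pq xy by algebra
    moreover have "q\<^sup>2 > 0" "2 * (p - 1) * y\<^sup>2 \<ge> 0" using p q by simp_all
    ultimately have "((p - 1) * y)\<^sup>2 < (q * x)\<^sup>2" by linarith
    then have "(p - 1) * y < q * x" by (rule power2_less_imp_less) (use q x in simp)
    then have "y' < y" by (simp add: y'_def algebra_simps)
    then have "nat y' < nat y" using y' by simp
    from less.hyps[OF this x' y' eq] obtain n where
      n: "2 * x' = gen_lucas (2 * p) (- 1) n" "y' = q * gen_fib (2 * p) (- 1) n" by blast
    have "2 * x = gen_lucas (2 * p) (- 1) (Suc n)"
    proof -
      \<comment> \<open>Multiplying back by \<open>p + q sqrt(d)\<close> recovers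
        \<open>(x, y)\<close>; then \<open>d * q^2 = p^2 - 1\<close> matches the coupled
        recurrence.\<close>
      have "x = p * x' + d * q * y'" using pq unfolding x'_def y'_def by algebra
      then show ?thesis
        unfolding gen_fib_lucas_Suc n(1)[symmetric] using n(2) pq by algebra
    qed
    moreover have "y = q * gen_fib (2 * p) (- 1) (Suc n)"
    proof -
      have "y = q * x' + p * y'" using pq unfolding x'_def y'_def by algebra
      then have "2 * y = q * (2 * gen_fib (2 * p) (- 1) (Suc n))"
        unfolding gen_fib_lucas_Suc n(1)[symmetric] using n(2) by algebra
      then show ?thesis by simp
    qed
    ultimately show ?thesis by blast
  qed
qed

text \<open>Descent gives one inclusion; the norm identity with positivity and parity gives the
  other.\<close>

lemma pell_solutions:
  fixes p q d :: int
  assumes d: "d \<ge> 0" and p: "p \<ge> 1" and q: "q \<ge> 1" and pq: "p\<^sup>2 - d * q\<^sup>2 = 1"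
    and desc: "\<And>x y. x > 0 \<Longrightarrow> y > 0 \<Longrightarrow> x\<^sup>2 - d * y\<^sup>2 = 1 \<Longrightarrow> q * x \<le> p * y"
  shows "{(of_int x, of_int y) | x y :: int. x > 0 \<and> y > 0 \<and> x\<^sup>2 - d * y\<^sup>2 = 1}
    = {(1 / 2 * of_int (gen_lucas (2 * p) (- 1) n) :: rat,
        of_int (q * gen_fib (2 * p) (- 1) n) :: rat) | n. n \<ge> 1}" (is "?L = ?R")
proof (intro equalityI subsetI)
  fix z assume "z \<in> ?L"
  then obtain x y :: int where z: "z = (of_int x, of_int y)"
    and xy: "x > 0" "y > 0" "x\<^sup>2 - d * y\<^sup>2 = 1" by blast
  have "\<exists>n. 2 * x = gen_lucas (2 * p) (- 1) n \<and> y = q * gen_fib (2 * p) (- 1) n"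
    by (rule pell_descent[OF d p q pq]) (use desc xy in simp_all)
  then obtain n where n: "2 * x = gen_lucas (2 * p) (- 1) n" "y = q * gen_fib (2 * p) (- 1) n"
    by blast
  have "n \<noteq> 0"
    using n(2) xy(2) by (intro notI) simp
  moreover have "of_int x = (1 / 2 * of_int (gen_lucas (2 * p) (- 1) n) :: rat)"
    by (simp flip: n(1))
  ultimately show "z \<in> ?R" unfolding z n(2)
    by (intro CollectI exI[of _ n]) simp
next
  fix z assume "z \<in> ?R"
  then obtain n where "n \<ge> 1" and z: "z = (1 / 2 * of_int (gen_lucas (2 * p) (- 1) n),
      of_int (q * gen_fib (2 * p) (- 1) n))" by blast
  obtain x where x: "gen_lucas (2 * p) (- 1) n = 2 * x"
    using even_gen_lucas by blast
  define y where "y = q * gen_fib (2 * p) (- 1) n"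
  have "x > 0" using gen_lucas_fib_pos[OF p, of n] x by simp
  moreover have "y > 0"
    using gen_fib_Suc_pos[OF p, of "n - 1"] \<open>n \<ge> 1\<close> q by (simp add: y_def)
  moreover have "4 * (x\<^sup>2 - d * y\<^sup>2) = (2 * x)\<^sup>2 - 4 * (p\<^sup>2 - 1) * (gen_fib (2 * p) (- 1) n)\<^sup>2"
    using pq unfolding y_def by algebra
  then have "x\<^sup>2 - d * y\<^sup>2 = 1"
    using gen_lucas_fib_pell[of p n] x by simp
  moreover have "z = (of_int x, of_int y)" unfolding z x y_def by simp
  ultimately show "z \<in> ?L" by blast
qed

theorem theorem5:
  fixes a b :: int
  assumes "a > 0" and "b > 0"
  shows "{(of_int x, of_int y) | x y :: int.
            x > 0 \<and> y > 0 \<and> x\<^sup>2 - (a\<^sup>2 * b\<^sup>2 - b) * y\<^sup>2 = 1}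
         = {pell_sol a b n | n. n \<ge> 1}"
proof -
  have "a\<^sup>2 * b \<ge> 1"
    using assms by (simp add: int_one_le_iff_zero_less)
  moreover have "a\<^sup>2 * b\<^sup>2 - b = b * (a\<^sup>2 * b - 1)" by algebra
  ultimately have d: "a\<^sup>2 * b\<^sup>2 - b \<ge> 0" using assms by simp
  show ?thesis
  proof (cases "b = 1")
    case True
    \<comment> \<open>Here \<open>d = a^2 - 1\<close> and \<open>(p, q) = (a, 1)\<close>. For
      \<open>a = 1\<close> this includes \<open>d = 0\<close>, where \<open>y\<close> is
      arbitrary.\<close>
    have "x \<le> a * y" if "x > 0" "y > 0" "x\<^sup>2 - (a\<^sup>2 * b\<^sup>2 - b) * y\<^sup>2 = 1" for x y
    proof (rule power2_le_imp_le)
      have "(a * y)\<^sup>2 - x\<^sup>2 = y\<^sup>2 - 1" using that(3) True by algebra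
      moreover have "y\<^sup>2 \<ge> 1" using that(2) by (simp add: int_one_le_iff_zero_less)
      ultimately show "x\<^sup>2 \<le> (a * y)\<^sup>2" by linarith
    qed (use assms that in simp)
    then show ?thesis
      using pell_solutions[OF d, of a 1] assms True by (simp add: pell_sol_def)
  next
    case False
    have "2 * a * x \<le> (2 * a\<^sup>2 * b - 1) * y"
      if "x > 0" "y > 0" "x\<^sup>2 - (a\<^sup>2 * b\<^sup>2 - b) * y\<^sup>2 = 1" for x y
    proof -
      have "(a * b * y)\<^sup>2 - x\<^sup>2 = b * y\<^sup>2 - 1" using that(3) by algebra
      \<comment> \<open>The bound 2, from \<open>b \<ge> 2\<close>, makes
        \<open>x < a * b * y\<close> strict; for \<open>b = 1\<close>, \<open>y = 1\<close> equality
        would occur.\<close>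
      moreover have "b * y\<^sup>2 \<ge> 2 * 1"
        using False assms that(2) by (intro mult_mono) (simp_all add: int_one_le_iff_zero_less)
      ultimately have "x\<^sup>2 < (a * b * y)\<^sup>2" by linarith
      then have "x < a * b * y"
        by (rule power2_less_imp_less) (use assms that in simp)
      then have "1\<^sup>2 \<le> (a * b * y - x)\<^sup>2" by (intro power_mono) simp_all
      moreover have "b * y * ((2 * a\<^sup>2 * b - 1) * y - 2 * a * x) = (a * b * y - x)\<^sup>2 - 1"
        using that(3) by algebra
      ultimately have "0 \<le> b * y * ((2 * a\<^sup>2 * b - 1) * y - 2 * a * x)"
        unfolding one_power2 by linarith
      moreover have "b * y > 0" using assms that by simp
      ultimately show ?thesis by (simp add: zero_le_mult_iff)
    qed
    moreover have "(2 * a\<^sup>2 * b - 1)\<^sup>2 - (a\<^sup>2 * b\<^sup>2 - b) * (2 * a)\<^sup>2 = 1" by algebra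
    ultimately have "{(of_int x, of_int y) | x y :: int.
          x > 0 \<and> y > 0 \<and> x\<^sup>2 - (a\<^sup>2 * b\<^sup>2 - b) * y\<^sup>2 = 1}
      = {(1 / 2 * of_int (gen_lucas (2 * (2 * a\<^sup>2 * b - 1)) (- 1) n) :: rat,
          of_int (2 * a * gen_fib (2 * (2 * a\<^sup>2 * b - 1)) (- 1) n) :: rat) | n. n \<ge> 1}"
      using \<open>a\<^sup>2 * b \<ge> 1\<close> assms by (intro pell_solutions[OF d]) simp_all
    moreover have "2 * (2 * a\<^sup>2 * b - 1) = 4 * a\<^sup>2 * b - 2" by simp
    ultimately show ?thesis using False by (simp only: pell_sol_def if_False)
  qed
qed

end
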